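(* There exists $N_0$ such that for every integer $N\ge N_0$, $$\#\big(W\cap\{1,\dots,N\}\big)\le N^{0.9999},$$ where $$W:=\Big\{n\in\mathbb Z\;:\;\exists k\ge0,\ T^k(n)=1\ \text{ and }\ \forall i\in I,\ \frac{c_i(n)}{\sum_{j\in I}c_j(n)}\le\frac16+0.0215\Big\}.$$
   Context: $T:\mathbb Z\to\mathbb Z$ is defined by $T(n)=3n+1$ if $n$ is odd and $T(n)=n/2$ if $n$ is even; $T^k$ is its $k$-th iterate. For $n\in\mathbb Z$, the orbit of $n$ is the set $\mathcal O_n:=\{m\in\mathbb Z: \exists k\ge0,\ m=T^k(n)\}$. For an integer $i$, $c_i(n):=\#\{m\in\mathcal O_n: m\equiv i \bmod 18\}$ (finite or infinite; it is finite when the orbit of $n$ contains $1$). $I:=\{1,5,7,11,13,17\}$. *)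

theory Defs
  imports Complex_Main "HOL-Number_Theory.Cong"
begin

definition T :: "int \<Rightarrow> int" where
  "T n = (if odd n then 3 * n + 1 else n div 2)"

definition orbit :: "int \<Rightarrow> int set" where
  "orbit n = {m. \<exists>k. m = (T ^^ k) n}"

text \<open>
  The cardinality may be infinite, in which case \<^const>\<open>card\<close> returns 0. Below, the count is
  used only when the orbit of \<open>n\<close> contains 1, and then the orbit is finite.
\<close>

definition c :: "int \<Rightarrow> int \<Rightarrow> nat" where
  "c i n = card {m \<in> orbit n. [m = i] (mod 18)}"

definition I :: "int set" where
  "I = {1, 5, 7, 11, 13, 17}"

text \<open>The denominator is positive, since 1 lies in the orbit of \<open>n\<close> and in \<open>I\<close>.\<close>

definition W :: "int set" where
  "W = {n. (\<exists>k. (T ^^ k) n = 1) \<and>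
           (\<forall>i\<in>I. real (c i n) / real (\<Sum>j\<in>I. c j n) \<le> 1 / 6 + 0.0215)}"

end

theory Submission
  imports Defs "HOL-Real_Asymp.Real_Asymp"
begin

text \<open>
  Only the odd members of an orbit that are prime to 3 matter. They form a path
  \<open>n\<^sub>0, n\<^sub>1, \<dots>, n\<^sub>L = 1\<close> of the accelerated map \<open>n \<mapsto> (3 n + 1) / 2\<^sup>a\<close>. Up to a factor polynomial
  in \<open>L\<close>, \<open>n\<^sub>0\<close> is the product of the \<open>2\<^sup>a / 3\<close> along the path, so \<open>n\<^sub>0\<close> to the power \<open>-0.999\<close> is
  at most the product of the \<open>3 \<cdot> 0.501\<^sup>a\<close>. Running the path backwards, the exponents \<open>a\<close> available
  at \<open>m\<close> depend only on \<open>m mod 18\<close>; dividing each factor by a bound \<open>\<beta>\<close> for the sum over the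
  available ones turns these products into subprobability weights on the paths of length \<open>L\<close>.
  If no class is visited with frequency above 4/21, the product of the normalising factors \<open>\<beta>\<close>
  decays exponentially in \<open>L\<close>. Hence the sum of \<open>n\<close> to the power \<open>-0.999\<close> over the odd \<open>n \<in> W\<close>
  prime to 3 converges. Passing to all of \<open>W\<close> costs two logarithmic factors.
\<close>

section \<open>The accelerated map and the relevant part of an orbit\<close>

definition halvings :: "int \<Rightarrow> nat" where
  "halvings n = multiplicity 2 (3 * n + 1)"

definition syracuse :: "int \<Rightarrow> int" where
  "syracuse n = (3 * n + 1) div 2 ^ halvings n"

text \<open>\<open>I\<close> consists of the units modulo 18, so this set determines all counts
  \<open>c i n\<close> with \<open>i \<in> I\<close> and also whether 1 is reached.\<close>

definition core :: "int \<Rightarrow> int set" where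
  "core n = {m \<in> orbit n. odd m \<and> \<not> 3 dvd m}"

lemma syracuse_eq: "2 ^ halvings n * syracuse n = 3 * n + 1"
  unfolding syracuse_def halvings_def by (rule dvd_mult_div_cancel, rule multiplicity_dvd)

lemma odd_syracuse: "odd (syracuse n)"
proof -
  have "3 * n + 1 \<noteq> 0" by presburger
  moreover have "\<not> is_unit (2::int)" by simp
  ultimately obtain y where y: "3 * n + 1 = 2 ^ halvings n * y" "odd y"
    unfolding halvings_def by (rule multiplicity_decompose')
  then have "syracuse n = y" by (simp add: syracuse_def)
  with y show ?thesis by simp
qed

lemma not_3_dvd_syracuse: "\<not> 3 dvd syracuse n"
proof
  assume "3 dvd syracuse n"
  then have "3 dvd 3 * n + 1" using syracuse_eq[of n] by (metis dvd_mult)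
  then show False by presburger
qed

lemma syracuse_pos:
  assumes "n > 0"
  shows "syracuse n > 0"
proof -
  have "2 ^ halvings n * syracuse n > 0" using assms by (simp add: syracuse_eq)
  then show ?thesis by (simp add: zero_less_mult_iff)
qed

lemma halvings_pos:
  assumes "odd n"
  shows "halvings n > 0"
proof (rule ccontr)
  assume "\<not> halvings n > 0"
  then have "syracuse n = 3 * n + 1" using syracuse_eq[of n] by simp
  then show False using odd_syracuse[of n] assms by simp
qed

lemma orbit_T: "orbit n = insert n (orbit (T n))"
proof -
  have "m \<in> orbit n \<longleftrightarrow> m = n \<or> m \<in> orbit (T n)" for m
  proof
    assume "m \<in> orbit n"
    then obtain k where "m = (T ^^ k) n" by (auto simp: orbit_def)
    then show "m = n \<or> m \<in> orbit (T n)"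
      by (cases k) (auto simp: orbit_def funpow_swap1)
  next
    assume "m = n \<or> m \<in> orbit (T n)"
    then show "m \<in> orbit n"
    proof
      assume "m = n"
      then have "m = (T ^^ 0) n" by simp
      then show ?thesis unfolding orbit_def by blast
    next
      assume "m \<in> orbit (T n)"
      then obtain k where "m = (T ^^ k) (T n)" by (auto simp: orbit_def)
      then have "m = (T ^^ Suc k) n" by (simp add: funpow_swap1)
      then show ?thesis unfolding orbit_def by blast
    qed
  qed
  then show ?thesis by blast
qed

lemma core_T:
  "core n = (if odd n \<and> \<not> 3 dvd n then insert n (core (T n)) else core (T n))"
  unfolding core_def by (subst orbit_T) auto

lemma core_pow2: "core (2 ^ k * m) = core m"
proof (induction k)
  case (Suc k)
  have "T (2 ^ Suc k * m) = 2 ^ k * m" by (simp add: T_def)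
  then show ?case using Suc core_T[of "2 ^ Suc k * m"] by simp
qed simp

lemma core_odd:
  assumes "odd n"
  shows "core n = (if 3 dvd n then core (syracuse n) else insert n (core (syracuse n)))"
proof -
  have "T n = 2 ^ halvings n * syracuse n" using assms by (simp add: T_def syracuse_eq)
  then show ?thesis using assms core_T[of n] by (simp add: core_pow2)
qed

lemma core_1: "core 1 = {1}"
proof -
  have "(T ^^ k) 1 \<in> {1, 2, 4}" for k
    by (induction k) (auto simp: T_def)
  then have "orbit 1 \<subseteq> {1, 2, 4}" by (auto simp: orbit_def)
  moreover have "1 \<in> orbit 1" using orbit_T[of 1] by simp
  ultimately show ?thesis by (auto simp: core_def)
qed

lemma core_path:
  assumes "odd n" "\<not> 3 dvd n" "(syracuse ^^ L) n = 1"
  shows "core n = (\<lambda>i. (syracuse ^^ i) n) ` {..L}"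
  using assms
proof (induction L arbitrary: n)
  case 0
  then show ?case by (simp add: core_1)
next
  case (Suc L)
  then have "core (syracuse n) = (\<lambda>i. (syracuse ^^ i) (syracuse n)) ` {..L}"
    by (intro Suc.IH) (auto simp: odd_syracuse not_3_dvd_syracuse funpow_swap1)
  also have "\<dots> = (\<lambda>i. (syracuse ^^ i) n) ` (Suc ` {..L})"
    by (simp add: image_image funpow_swap1)
  finally show ?case
    using core_odd[of n] Suc.prems by (simp add: atMost_Suc_eq_insert_0)
qed

text \<open>A \<open>T\<close>-step either removes a factor 2 or, at \<open>j = 0\<close>, begins a
  Syracuse step. Carrying the odd part \<open>m\<close> along makes the induction hypothesis apply
  in both cases.\<close>

lemma reaches_1:
  assumes "(T ^^ k) n = 1" "n = 2 ^ j * m" "odd m"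
  shows "\<exists>L. (syracuse ^^ L) m = 1"
  using assms
proof (induction k arbitrary: n j m)
  case 0
  then have "2 ^ j * m = 1" by simp
  then have "j = 0 \<or> even (1::int)" by (metis dvd_mult2 dvd_refl dvd_power neq0_conv)
  then have "m = 1" using \<open>2 ^ j * m = 1\<close> by simp
  then show ?case by (intro exI[of _ 0]) simp
next
  case (Suc k)
  have T: "(T ^^ k) (T n) = 1" using Suc.prems by (simp add: funpow_swap1)
  show ?case
  proof (cases j)
    case 0
    then have "T n = 2 ^ halvings m * syracuse m" using Suc.prems by (simp add: T_def syracuse_eq)
    then obtain L where "(syracuse ^^ L) (syracuse m) = 1" using Suc.IH[OF T] odd_syracuse by blast
    then have "(syracuse ^^ Suc L) m = 1" by (simp add: funpow_swap1)
    then show ?thesis by blast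
  next
    case (Suc j')
    then have "T n = 2 ^ j' * m" using Suc.prems by (simp add: T_def)
    then show ?thesis using Suc.IH[OF T] Suc.prems by blast
  qed
qed

lemma c_core:
  assumes "i \<in> I"
  shows "c i n = card {m \<in> core n. m mod 18 = i}"
proof -
  have "[m = i] (mod 18) \<longleftrightarrow> m mod 18 = i" for m
    using assms by (auto simp: I_def unique_euclidean_semiring_class.cong_def)
  moreover have "odd m \<and> \<not> 3 dvd m" if "m mod 18 = i" for m
    using assms that unfolding I_def by (elim insertE emptyE; simp; presburger)
  ultimately have "{m \<in> orbit n. [m = i] (mod 18)} = {m \<in> core n. m mod 18 = i}"
    by (auto simp: core_def)
  then show ?thesis by (simp add: c_def)
qed

text \<open>Serves to move membership from a number to its odd part, and from an odd multiple of 3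
  to its Syracuse image.\<close>

lemma W_core:
  assumes "core n = core m"
  shows "n \<in> W \<longleftrightarrow> m \<in> W"
proof -
  have c: "c i n = c i m" if "i \<in> I" for i using that assms by (simp add: c_core)
  have reach: "(\<exists>k. (T ^^ k) n = 1) \<longleftrightarrow> 1 \<in> core n" for n
    by (auto simp: core_def orbit_def intro: sym)
  have "(\<Sum>j\<in>I. c j n) = (\<Sum>j\<in>I. c j m)" by (intro sum.cong refl c)
  then show ?thesis unfolding W_def using c assms by (simp add: reach)
qed

section \<open>Predecessors and residue classes modulo 18\<close>

lemma mod_18_in_I:
  assumes "odd (m::int)" "\<not> 3 dvd m"
  shows "m mod 18 \<in> I"
proof -
  have "0 \<le> m mod 18" "m mod 18 < 18" by auto
  moreover have "odd (m mod 18)" "\<not> 3 dvd m mod 18"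
    using assms by (simp_all add: dvd_mod_iff)
  ultimately show ?thesis unfolding I_def by simp presburger
qed

text \<open>
  The value \<open>\<beta>\<^sub>r\<close> at \<open>r \<in> I\<close> is \<open>3 (x\<^sup>p + x\<^sup>q) / (1 - x\<^sup>6)\<close> for \<open>x = 0.501\<close>, rounded up, where \<open>p\<close> and
  \<open>q\<close> are the two smallest \<open>a > 0\<close> for which \<open>(2\<^sup>a m - 1) / 3\<close> is an integer prime to 3 when
  \<open>m mod 18 = r\<close>. The numerical fact behind the theorem is that \<open>\<beta>\<^sub>7\<close> times the fourth power
  of the product of the other five values is below 1: with all frequencies at most 4/21, which exceeds
  1/6 + 0.0215, the class 7 of smallest \<open>\<beta>\<close> has frequency at least 1/21.
\<close>

definition branch_bound :: "int \<Rightarrow> real" where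
  "branch_bound r = (if r = 1 then 0.96 else if r = 5 then 0.48 else if r = 7 then 0.241
    else if r = 11 then 1.92 else if r = 13 then 0.82 else 1.63)"

lemma branch_bound_ge: "branch_bound r \<ge> 0.241"
  by (simp add: branch_bound_def)

lemma sum_two_progressions:
  fixes x :: real
  assumes "0 < x" "x < 1" "finite A" "\<And>a. a \<in> A \<Longrightarrow> \<exists>k. a = p + 6 * k \<or> a = q + 6 * k"
  shows "(\<Sum>a\<in>A. x ^ a) \<le> (x ^ p + x ^ q) / (1 - x ^ 6)"
proof -
  \<comment> \<open>\<open>insert 0\<close> covers empty \<open>A\<close>. As
    \<open>k \<le> a\<close>, \<open>M\<close> bounds the indices of both progressions too.\<close>
  define M where "M = Suc (Max (insert 0 A))"
  have M: "a < M" if "a \<in> A" for a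
    using that assms(3) by (auto simp: M_def less_Suc_eq_le intro: Max_ge)
  have x6: "x ^ 6 < 1" using assms by (simp add: power_less_one_iff)
  have geo: "(\<Sum>k<M. x ^ (r + 6 * k)) \<le> x ^ r / (1 - x ^ 6)" for r
  proof -
    have "(\<Sum>k<M. x ^ (r + 6 * k)) = x ^ r * (\<Sum>k<M. (x ^ 6) ^ k)"
      by (simp add: power_add power_mult sum_distrib_left)
    also have "\<dots> = x ^ r * ((1 - (x ^ 6) ^ M) / (1 - x ^ 6))"
      using x6 by (subst sum_gp_strict) auto
    also have "\<dots> \<le> x ^ r * (1 / (1 - x ^ 6))"
      using x6 assms by (intro mult_left_mono divide_right_mono) auto
    finally show ?thesis by simp
  qed
  have "A \<subseteq> (\<lambda>k. p + 6 * k) ` {..<M} \<union> (\<lambda>k. q + 6 * k) ` {..<M}" (is "_ \<subseteq> ?P \<union> ?Q")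
    using assms(4) M by fastforce
  then have "(\<Sum>a\<in>A. x ^ a) \<le> (\<Sum>a\<in>?P \<union> ?Q. x ^ a)"
    using assms by (intro sum_mono2) auto
  also have "\<dots> \<le> (\<Sum>a\<in>?P. x ^ a) + (\<Sum>a\<in>?Q. x ^ a)"
    using assms by (subst sum_Un) (auto intro!: sum_nonneg)
  also have "\<dots> = (\<Sum>k<M. x ^ (p + 6 * k)) + (\<Sum>k<M. x ^ (q + 6 * k))"
    by (simp add: sum.reindex inj_on_def)
  also have "\<dots> \<le> x ^ p / (1 - x ^ 6) + x ^ q / (1 - x ^ 6)"
    by (intro add_mono geo)
  finally show ?thesis by (simp add: add_divide_distrib)
qed

lemma pow2_mod_9: "(2::int) ^ a mod 9 = 2 ^ (a mod 6) mod 9"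
proof -
  have "(2::int) ^ a = (2 ^ 6) ^ (a div 6) * 2 ^ (a mod 6)"
    by (metis mult_div_mod_eq power_add power_mult)
  also have "\<dots> mod 9 = ((2 ^ 6) mod 9) ^ (a div 6) * 2 ^ (a mod 6) mod 9"
    by (metis mod_mult_left_eq power_mod)
  finally show ?thesis by simp
qed

text \<open>Only meaningful for \<open>r \<in> I\<close>; the last branch is the class 17.\<close>

definition branch_residues :: "int \<Rightarrow> nat set" where
  "branch_residues r = (if r = 1 then {2, 4} else if r = 5 then {3, 5} else if r = 7 then {4, 0}
    else if r = 11 then {1, 3} else if r = 13 then {2, 0} else {1, 5})"

text \<open>4 and 7 are the residues of \<open>3 * n + 1\<close> modulo 9 for \<open>n\<close> prime
  to 3. Six exponents suffice because 2 has order 6 modulo 9.\<close>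

lemma residue_table:
  "\<forall>r\<in>I. \<forall>e\<in>{0, 1, 2, 3, 4, 5}. (2 ^ e mod 9) * (r mod 9) mod 9 \<in> {4, 7} \<longrightarrow> e \<in> branch_residues r"
  by (simp add: I_def branch_residues_def)

lemma predecessor_exponents:
  fixes m :: int
  assumes "m mod 18 \<in> I" "2 ^ a * m mod 9 \<in> {4, 7}"
  shows "a mod 6 \<in> branch_residues (m mod 18)"
proof -
  have "m mod 9 = (m mod 18) mod 9" by (simp add: mod_mod_cancel)
  then have "2 ^ a * m mod 9 = (2 ^ (a mod 6) mod 9) * ((m mod 18) mod 9) mod 9"
    by (metis mod_mult_eq pow2_mod_9)
  then have *: "(2 ^ (a mod 6) mod 9) * ((m mod 18) mod 9) mod 9 \<in> {4, 7}"
    using assms(2) by (simp only:)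
  have "a mod 6 < 6" by simp
  then have "a mod 6 \<in> {0, 1, 2, 3, 4, 5}" unfolding insert_iff by linarith
  then show ?thesis by (rule residue_table[rule_format, OF assms(1) _ *])
qed

text \<open>\<open>p \<le> 6\<close> admits 6 as the representative of residue 0, where it is the
  least positive exponent.\<close>

lemma exists_add_6_mult:
  assumes "a mod 6 = p mod 6" "p \<le> 6" "a > 0"
  shows "\<exists>k. a = p + 6 * (k::nat)"
proof (cases "p = 6")
  case True
  then have "a = 6 * (a div 6)" using assms by presburger
  moreover from this have "a div 6 > 0" using assms by (metis mult_0_right neq0_conv)
  ultimately have "a = p + 6 * (a div 6 - 1)" using True by linarith
  then show ?thesis by blast
next
  case False
  then have "a mod 6 = p" using assms by simp
  then have "a = p + 6 * (a div 6)" by (metis add.commute mult_div_mod_eq)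
  then show ?thesis by blast
qed

lemma sum_predecessors:
  fixes m :: int
  assumes "m mod 18 \<in> I" "finite A"
    and A: "\<And>a. a \<in> A \<Longrightarrow> a > 0 \<and> 2 ^ a * m mod 9 \<in> {4, 7}"
  shows "(\<Sum>a\<in>A. 3 * 0.501 ^ a) \<le> branch_bound (m mod 18)"
proof -
  have bound: "(\<Sum>a\<in>A. 3 * 0.501 ^ a) \<le> branch_bound r"
    if r: "m mod 18 = r" and branch_residues: "branch_residues r = {p mod 6, q mod 6}" "p \<le> 6" "q \<le> 6"
      and le: "3 * ((0.501 ^ p + 0.501 ^ q) / (1 - 0.501 ^ 6)) \<le> branch_bound r" for p q r
  proof -
    have "\<exists>k. a = p + 6 * k \<or> a = q + 6 * k" if "a \<in> A" for a
    proof -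
      have "a mod 6 \<in> {p mod 6, q mod 6}"
        using predecessor_exponents[OF assms(1) conjunct2[OF A[OF that]]] r branch_residues(1)
        by (simp only:)
      then show ?thesis using exists_add_6_mult branch_residues(2,3) A[OF that] by blast
    qed
    then have "(\<Sum>a\<in>A. 0.501 ^ a) \<le> ((0.501 ^ p + 0.501 ^ q) / (1 - 0.501 ^ 6) :: real)"
      by (intro sum_two_progressions assms(2)) auto
    then have "3 * (\<Sum>a\<in>A. 0.501 ^ a) \<le> branch_bound r" using le by linarith
    then show ?thesis by (simp only: sum_distrib_left)
  qed
  have "(\<Sum>a\<in>A. 3 * 0.501 ^ a) \<le> branch_bound r" if "m mod 18 = r" "r \<in> {1, 5, 7, 11, 13, 17}" for r
    using that(2)
  proof (elim insertE emptyE)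
    assume r: "r = 1"
    show ?thesis
      by (rule bound[OF that(1), of 2 4])
        (simp_all add: r branch_bound_def branch_residues_def power_divide)
  next
    assume r: "r = 5"
    show ?thesis
      by (rule bound[OF that(1), of 3 5])
        (simp_all add: r branch_bound_def branch_residues_def power_divide)
  next
    assume r: "r = 7"
    show ?thesis
      by (rule bound[OF that(1), of 4 6])
        (simp_all add: r branch_bound_def branch_residues_def power_divide)
  next
    assume r: "r = 11"
    show ?thesis
      by (rule bound[OF that(1), of 1 3])
        (simp_all add: r branch_bound_def branch_residues_def power_divide)
  next
    assume r: "r = 13"
    show ?thesis
      by (rule bound[OF that(1), of 2 6])
        (simp_all add: r branch_bound_def branch_residues_def power_divide)
  next
    assume r: "r = 17"
    show ?thesis
      by (rule bound[OF that(1), of 1 5])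
        (simp_all add: r branch_bound_def branch_residues_def power_divide)
  qed
  then show ?thesis using assms(1) unfolding I_def by blast
qed

lemma syracuse_residue:
  assumes "odd n" "\<not> 3 dvd n"
  shows "halvings n > 0 \<and> 2 ^ halvings n * syracuse n mod 9 \<in> {4, 7}"
proof -
  have "(3 * n + 1) mod 9 \<in> {4, 7}" using assms(2) by simp presburger
  then show ?thesis using halvings_pos[OF assms(1)] by (simp add: syracuse_eq)
qed

section \<open>Subprobability weights on backward paths\<close>

text \<open>Each factor is normalised at the successor, since predecessors are summed with their
  successor fixed.\<close>

definition path_weight :: "nat \<Rightarrow> int \<Rightarrow> real" where
  "path_weight L n = (\<Prod>i<L. 3 * 0.501 ^ halvings ((syracuse ^^ i) n)
    / branch_bound ((syracuse ^^ Suc i) n mod 18))"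

lemma branch_bound_pos: "branch_bound r > 0"
  using branch_bound_ge[of r] by simp

lemma path_weight_nonneg: "path_weight L n \<ge> 0"
  unfolding path_weight_def by (intro prod_nonneg) (auto intro!: divide_nonneg_pos branch_bound_pos)

lemma path_weight_Suc:
  "path_weight (Suc L) n =
    3 * 0.501 ^ halvings n / branch_bound (syracuse n mod 18) * path_weight L (syracuse n)"
  unfolding path_weight_def
  by (simp only: prod.lessThan_Suc_shift funpow_swap1 o_def) (simp add: funpow_swap1)

text \<open>Group the starting points by Syracuse image. Within a fibre the exponent determines the
  point, so \<open>sum_predecessors\<close> bounds the sum of the first factors before
  normalisation.\<close>

lemma sum_path_weight_le_1:
  assumes "finite F" "\<And>n. n \<in> F \<Longrightarrow> odd n \<and> \<not> 3 dvd n \<and> (syracuse ^^ L) n = 1"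
  shows "(\<Sum>n\<in>F. path_weight L n) \<le> 1"
  using assms
proof (induction L arbitrary: F)
  case 0
  then have "F \<subseteq> {1}" by auto
  then have "card F \<le> card {1::int}" by (intro card_mono) auto
  then show ?case by (simp add: path_weight_def)
next
  case (Suc L)
  have fiber: "(\<Sum>n\<in>{n \<in> F. syracuse n = m}. path_weight (Suc L) n) \<le> path_weight L m"
    if "m \<in> syracuse ` F" for m
  proof -
    let ?F = "{n \<in> F. syracuse n = m}"
    have m: "odd m" "\<not> 3 dvd m" using that by (auto simp: odd_syracuse not_3_dvd_syracuse)
    have "inj_on halvings ?F"
    proof (rule inj_onI)
      fix a b assume "a \<in> ?F" "b \<in> ?F" "halvings a = halvings b"
      then have "3 * a + 1 = 3 * b + 1" using syracuse_eq[of a] syracuse_eq[of b] by simp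
      then show "a = b" by simp
    qed
    then have "(\<Sum>n\<in>?F. 3 * 0.501 ^ halvings n) = (\<Sum>a\<in>halvings ` ?F. 3 * 0.501 ^ a :: real)"
      by (simp add: sum.reindex)
    also have "\<dots> \<le> branch_bound (m mod 18)"
    proof (rule sum_predecessors)
      show "m mod 18 \<in> I" using m by (rule mod_18_in_I)
      show "finite (halvings ` ?F)" using Suc.prems by simp
      show "a > 0 \<and> 2 ^ a * m mod 9 \<in> {4, 7}" if "a \<in> halvings ` ?F" for a
        using that syracuse_residue Suc.prems(2) by blast
    qed
    finally have le: "(\<Sum>n\<in>?F. 3 * 0.501 ^ halvings n) \<le> branch_bound (m mod 18)" .
    have "(\<Sum>n\<in>?F. path_weight (Suc L) n) =
        (\<Sum>n\<in>?F. 3 * 0.501 ^ halvings n * (path_weight L m / branch_bound (m mod 18)))"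
      by (intro sum.cong) (auto simp: path_weight_Suc)
    also have "\<dots> = (\<Sum>n\<in>?F. 3 * 0.501 ^ halvings n) * (path_weight L m / branch_bound (m mod 18))"
      by (rule sum_distrib_right[symmetric])
    also have "\<dots> \<le> branch_bound (m mod 18) * (path_weight L m / branch_bound (m mod 18))"
      using le path_weight_nonneg branch_bound_pos[of "m mod 18"]
      by (intro mult_right_mono) (auto simp: less_imp_le)
    also have "\<dots> = path_weight L m" using branch_bound_pos[of "m mod 18"] by simp
    finally show ?thesis .
  qed
  have "(\<Sum>n\<in>F. path_weight (Suc L) n) =
      (\<Sum>m\<in>syracuse ` F. \<Sum>n\<in>{n \<in> F. syracuse n = m}. path_weight (Suc L) n)"
    using Suc.prems(1) by (rule sum.image_gen)
  also have "\<dots> \<le> (\<Sum>m\<in>syracuse ` F. path_weight L m)" by (intro sum_mono fiber)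
  also have "\<dots> \<le> 1"
    using Suc.prems by (intro Suc.IH) (auto simp: odd_syracuse not_3_dvd_syracuse funpow_swap1)
  finally show ?case .
qed

section \<open>Decay of the normalising factors\<close>

lemma finite_I: "finite I"
  by (simp add: I_def)

text \<open>After division by the smallest value 0.241 all bases are at least 1, so every exponent
  may be raised to its maximum. The 21st power keeps the exponents integral.\<close>

lemma prod_branch_bound_le:
  fixes k :: "int \<Rightarrow> nat"
  assumes M: "M = (\<Sum>r\<in>I. k r)" and k: "\<And>r. r \<in> I \<Longrightarrow> 21 * k r \<le> 4 * M"
  shows "(\<Prod>r\<in>I. branch_bound r ^ k r) \<le> 0.97 ^ M"
proof -
  let ?l = "0.241 :: real"
  have "(\<Prod>r\<in>I. branch_bound r ^ k r) ^ 21 = (\<Prod>r\<in>I. ?l ^ (21 * k r) * (branch_bound r / ?l) ^ (21 * k r))"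
    by (simp add: prod_power_distrib power_mult[symmetric] mult.commute power_mult_distrib[symmetric])
  also have "\<dots> = ?l ^ (21 * M) * (\<Prod>r\<in>I. (branch_bound r / ?l) ^ (21 * k r))"
    unfolding M by (simp only: prod.distrib power_sum sum_distrib_left)
  also have "\<dots> \<le> ?l ^ (21 * M) * (\<Prod>r\<in>I. (branch_bound r / ?l) ^ (4 * M))"
    using branch_bound_ge by (intro mult_left_mono prod_mono conjI power_increasing k zero_le_power)
      (auto simp: field_simps intro: order_trans[OF _ branch_bound_ge])
  also have "\<dots> = (?l ^ 21 * (\<Prod>r\<in>I. branch_bound r / ?l) ^ 4) ^ M"
    by (simp add: power_mult power_mult_distrib prod_power_distrib)
  \<comment> \<open>The base on the left is about 0.471, and \<open>0.97 ^ 21\<close> is about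
    0.527.\<close>
  also have "\<dots> \<le> (0.97 ^ 21) ^ M"
    by (intro power_mono) (simp_all add: I_def branch_bound_def power_divide)
  also have "\<dots> = (0.97 ^ M) ^ 21" by (simp only: power_mult[symmetric] mult.commute)
  finally show ?thesis by (rule power_le_imp_le_base[of _ 20, simplified]) auto
qed

section \<open>Size of the starting point of a path\<close>

text \<open>
  The factors \<open>1 + 1 / (3 n\<^sub>i)\<close> separate \<open>n\<close> from the product of the \<open>2\<^sup>a / 3\<close> along its path.
  As the \<open>n\<^sub>i\<close> are distinct, they cost only a factor linear in the length.
\<close>

lemma prod_distinct_le:
  fixes A :: "int set"
  assumes "finite A" "\<And>m. m \<in> A \<Longrightarrow> m > 0"
  shows "(\<Prod>m\<in>A. 1 + 1 / (3 * real_of_int m)) \<le> card A + 1"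
  using assms
proof (induction A rule: finite_linorder_max_induct)
  case (insert a A)
  \<comment> \<open>At most \<open>a - 1\<close> positive integers lie below \<open>a\<close>, so
    the factor for \<open>a\<close> raises the bound by at most 1/3.\<close>
  have "A \<subseteq> {1..<a}" using insert by force
  then have "card A \<le> card {1..<a}" by (intro card_mono) auto
  then have a: "real (card A) + 1 \<le> a" using insert.prems[of a] by simp
  have "a \<notin> A" using insert by auto
  then have "(\<Prod>m\<in>insert a A. 1 + 1 / (3 * real_of_int m))
      = (1 + 1 / (3 * real_of_int a)) * (\<Prod>m\<in>A. 1 + 1 / (3 * real_of_int m))"
    using insert by simp
  also have "\<dots> \<le> (1 + 1 / (3 * real_of_int a)) * (card A + 1)"
    using insert insert.prems[of a]
    by (intro mult_left_mono) (auto intro!: add_nonneg_nonneg simp: less_imp_le)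
  also have "\<dots> \<le> card A + 2"
    using a insert.prems[of a] by (simp add: field_simps)
  finally show ?case using insert \<open>a \<notin> A\<close> by simp
qed simp

text \<open>Telescopes, since \<open>m * (1 + 1 / (3 * m))\<close> equals
  \<open>2 ^ halvings m / 3 * syracuse m\<close>.\<close>

lemma path_product:
  assumes "n > 0"
  shows "real_of_int n * (\<Prod>i<L. 1 + 1 / (3 * real_of_int ((syracuse ^^ i) n)))
    = (\<Prod>i<L. 2 ^ halvings ((syracuse ^^ i) n) / 3) * real_of_int ((syracuse ^^ L) n)"
proof (induction L)
  case (Suc L)
  let ?m = "(syracuse ^^ L) n"
  have "?m > 0" using assms by (induction L) (auto simp: syracuse_pos)
  then have "real_of_int ?m * (1 + 1 / (3 * real_of_int ?m)) = real_of_int (3 * ?m + 1) / 3"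
    by (simp add: field_simps)
  also have "\<dots> = 2 ^ halvings ?m / 3 * real_of_int (syracuse ?m)" by (simp flip: syracuse_eq)
  finally show ?case using Suc by (simp add: mult.assoc) (simp add: mult.assoc[symmetric])
qed simp

text \<open>Cutting out the loop between two equal members would reach \<open>e\<close> before time
  \<open>L\<close>.\<close>

lemma inj_on_path:
  fixes f :: "'a \<Rightarrow> 'a"
  assumes "(f ^^ L) n = e" "\<And>i. i < L \<Longrightarrow> (f ^^ i) n \<noteq> e"
  shows "inj_on (\<lambda>i. (f ^^ i) n) {..L}"
proof (rule linorder_inj_onI)
  fix i j assume ij: "i < j" "i \<in> {..L}" "j \<in> {..L}"
  show "(f ^^ i) n \<noteq> (f ^^ j) n"
  proof
    assume eq: "(f ^^ i) n = (f ^^ j) n"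
    have "(f ^^ (L - j + i)) n = (f ^^ (L - j)) ((f ^^ j) n)" by (simp add: funpow_add eq)
    also have "\<dots> = (f ^^ (L - j + j)) n" by (simp add: funpow_add)
    also have "\<dots> = e" using ij assms(1) by simp
    finally have "(f ^^ (L - j + i)) n = e" .
    moreover have "L - j + i < L" using ij by simp
    ultimately show False using assms(2) by blast
  qed
qed auto

text \<open>Amounts to \<open>2 powr 0.001 \<le> 1.002\<close>; Bernoulli even gives
  \<open>1.002 ^ 1000 \<ge> 3\<close>.\<close>

lemma two_powr_le: "2 powr - 0.999 \<le> (0.501 :: real)"
proof -
  have root: "(x ^ k) powr (1 / real k) = x" if "x > 0" "k > 0" for x :: real and k
    using that by (simp add: powr_powr flip: powr_realpow)
  have "2 \<le> 1 + real 1000 * 0.002" by simp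
  also have "\<dots> \<le> (1 + 0.002) ^ 1000" by (rule Bernoulli_inequality) simp
  finally have "2 powr (1 / real 1000) \<le> ((1 + 0.002) ^ 1000 :: real) powr (1 / real 1000)"
    by (intro powr_mono2) simp_all
  also have "\<dots> = 1 + 0.002" by (rule root) simp_all
  finally have le: "2 powr 0.001 \<le> (1.002 :: real)" by simp
  have "2 powr - 0.999 = 2 powr (0.001 - 1 :: real)" by simp
  also have "\<dots> = 2 powr 0.001 / 2" by (subst powr_diff) simp
  finally show ?thesis using le by simp
qed

lemma powr_le_path:
  assumes n: "n > 0" and L: "(syracuse ^^ L) n = 1" "\<And>i. i < L \<Longrightarrow> (syracuse ^^ i) n \<noteq> 1"
  shows "real_of_int n powr - 0.999 \<le> (real L + 1) * (\<Prod>i<L. 3 * 0.501 ^ halvings ((syracuse ^^ i) n))"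
proof -
  define P where "P = (\<Prod>i<L. 1 + 1 / (3 * real_of_int ((syracuse ^^ i) n)))"
  define Q :: real where "Q = (\<Prod>i<L. 2 ^ halvings ((syracuse ^^ i) n) / 3)"
  have pos: "(syracuse ^^ i) n > 0" for i using n by (induction i) (auto simp: syracuse_pos)
  have inj: "inj_on (\<lambda>i. (syracuse ^^ i) n) {..<L}"
    using inj_on_path[OF L] by (rule inj_on_subset) auto
  have "P = (\<Prod>m\<in>(\<lambda>i. (syracuse ^^ i) n) ` {..<L}. 1 + 1 / (3 * real_of_int m))"
    unfolding P_def by (simp add: prod.reindex[OF inj])
  also have "\<dots> \<le> card ((\<lambda>i. (syracuse ^^ i) n) ` {..<L}) + 1"
    using pos by (intro prod_distinct_le) auto
  finally have P: "P \<le> real L + 1" by (simp add: card_image[OF inj])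
  have P1: "P \<ge> 1" unfolding P_def using pos by (intro prod_ge_1) (simp add: less_imp_le)
  have Q0: "Q > 0" unfolding Q_def by (intro prod_pos) simp
  have "real_of_int n * P = Q" using path_product[OF n, of L] L by (simp add: P_def Q_def)
  then have "real_of_int n = Q * inverse P" using P1 by (simp add: field_simps)
  then have "real_of_int n powr - 0.999 = Q powr - 0.999 * inverse P powr - 0.999"
    using Q0 P1 by (simp add: powr_mult)
  also have "inverse P powr - 0.999 = P powr 0.999"
    using P1 by (simp add: powr_minus inverse_powr)
  also have "P powr 0.999 \<le> P powr 1" using P1 by (intro powr_mono) auto
  also have "P powr 1 \<le> real L + 1" using P P1 by simp
  also have "Q powr - 0.999 \<le> (\<Prod>i<L. 3 * 0.501 ^ halvings ((syracuse ^^ i) n))"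
  proof -
    have "(2 ^ a / 3) powr - 0.999 \<le> 3 * (0.501 :: real) ^ a" for a :: nat
    proof -
      have "(2 ^ a / 3 :: real) powr - 0.999 = (2 ^ a) powr - 0.999 / 3 powr - 0.999"
        by (simp add: powr_divide)
      also have "\<dots> = 3 powr 0.999 * (2 powr - 0.999) ^ a"
        by (simp add: powr_powr powr_minus divide_simps mult.commute flip: powr_realpow)
      also have "\<dots> \<le> 3 powr 1 * 0.501 ^ a"
        by (intro mult_mono power_mono powr_mono two_powr_le) auto
      finally show ?thesis by simp
    qed
    then show ?thesis
      unfolding Q_def by (subst prod_powr_distrib) (auto intro!: prod_mono)
  qed
  finally show ?thesis by (simp add: mult.commute mult_left_mono mult_right_mono)
qed

section \<open>Counting the odd elements of \<open>W\<close> prime to 3\<close>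

lemma W_weight:
  assumes W: "n \<in> W" and n: "n > 0" "odd n" "\<not> 3 dvd n"
  shows "\<exists>L. (syracuse ^^ L) n = 1
    \<and> real_of_int n powr - 0.999 \<le> 5 * (real L + 1) * 0.97 ^ (L + 1) * path_weight L n"
proof -
  obtain k where "(T ^^ k) n = 1" using W by (auto simp: W_def)
  then have ex: "\<exists>L. (syracuse ^^ L) n = 1" using reaches_1[of k n 0 n] n by simp
  \<comment> \<open>1 is a fixed point of \<open>syracuse\<close>, so the members up to time
    \<open>L\<close> are distinct only for the least \<open>L\<close>.\<close>
  define L where "L = (LEAST L. (syracuse ^^ L) n = 1)"
  have L: "(syracuse ^^ L) n = 1" unfolding L_def using ex by (rule LeastI_ex)
  have least: "(syracuse ^^ i) n \<noteq> 1" if "i < L" for i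
    using that unfolding L_def by (rule not_less_Least)
  have inj: "inj_on (\<lambda>i. (syracuse ^^ i) n) {..L}" by (rule inj_on_path[OF L least])
  have core: "core n = (\<lambda>i. (syracuse ^^ i) n) ` {..L}" by (rule core_path[OF n(2,3) L])
  then have fin: "finite (core n)" by simp
  have card: "card (core n) = L + 1" unfolding core by (simp add: card_image[OF inj])
  have in_I: "(\<lambda>m. m mod 18) ` core n \<subseteq> I" by (auto simp: core_def intro: mod_18_in_I)
  have c: "c r n = card {m \<in> core n. m mod 18 = r}" if "r \<in> I" for r
    using that by (rule c_core)
  have "(\<Sum>r\<in>I. \<Sum>m\<in>{m \<in> core n. m mod 18 = r}. 1) = (\<Sum>m\<in>core n. 1 :: nat)"
    by (rule sum.group[OF fin finite_I in_I])
  then have sum: "L + 1 = (\<Sum>r\<in>I. c r n)" by (simp add: c card)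
  have freq: "21 * c r n \<le> 4 * (L + 1)" if "r \<in> I" for r
  proof -
    have "real (c r n) / real (L + 1) \<le> 1 / 6 + 0.0215"
      using W that unfolding sum by (auto simp: W_def)
    then have "real (c r n) \<le> (1 / 6 + 0.0215) * real (L + 1)"
      by (subst (asm) pos_divide_le_eq) simp_all
    then have "21 * real (c r n) \<le> 4 * real (L + 1)" by (simp add: algebra_simps)
    then show ?thesis by linarith
  qed
  define X where "X = (\<Prod>i<L. branch_bound ((syracuse ^^ Suc i) n mod 18))"
  have X: "X \<ge> 0"
    unfolding X_def using branch_bound_pos by (intro prod_nonneg) (auto simp: less_imp_le)
  \<comment> \<open>The counts include the starting point, which \<open>X\<close> omits. Its factor
    is at least 0.241, more than 1/5; hence the 5 in \<open>X_le\<close>.\<close>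
  have "0.241 * X \<le> branch_bound (n mod 18) * X" by (intro mult_right_mono branch_bound_ge X)
  also have "\<dots> = (\<Prod>i\<le>L. branch_bound ((syracuse ^^ i) n mod 18))"
    unfolding X_def lessThan_Suc_atMost[symmetric] by (subst prod.lessThan_Suc_shift) simp
  also have "\<dots> = (\<Prod>m\<in>core n. branch_bound (m mod 18))"
    unfolding core by (simp add: prod.reindex[OF inj])
  also have "\<dots> = (\<Prod>r\<in>I. \<Prod>m\<in>{m \<in> core n. m mod 18 = r}. branch_bound (m mod 18))"
    by (rule prod.group[symmetric, OF fin finite_I in_I])
  also have "\<dots> = (\<Prod>r\<in>I. branch_bound r ^ c r n)"
    by (intro prod.cong refl) (simp add: c)
  also have "\<dots> \<le> 0.97 ^ (L + 1)" using sum freq by (rule prod_branch_bound_le)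
  finally have X_le: "X \<le> 5 * 0.97 ^ (L + 1)" using X by simp
  have "path_weight L n * X = (\<Prod>i<L. 3 * 0.501 ^ halvings ((syracuse ^^ i) n))"
    unfolding X_def path_weight_def prod.distrib[symmetric]
    using branch_bound_pos by (intro prod.cong refl) (simp add: less_imp_neq[symmetric])
  then have "real_of_int n powr - 0.999 \<le> (real L + 1) * (path_weight L n * X)"
    using powr_le_path[OF n(1) L least] by simp
  also have "\<dots> \<le> (real L + 1) * (path_weight L n * (5 * 0.97 ^ (L + 1)))"
    by (intro mult_left_mono X_le path_weight_nonneg) simp
  finally show ?thesis using L by (intro exI[of _ L]) (simp add: algebra_simps)
qed

definition W0 :: "int \<Rightarrow> int set" where
  "W0 N = {n \<in> W. 0 < n \<and> n \<le> N \<and> odd n \<and> \<not> 3 dvd n}"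

lemma finite_W0: "finite (W0 N)"
  by (rule finite_subset[of _ "{1..N}"]) (auto simp: W0_def)

text \<open>Rankin's trick: for \<open>n \<le> N\<close> the term \<open>n powr - 0.999\<close> is
  at least \<open>N powr - 0.999\<close>. Sorted by path length \<open>L\<close>, these terms sum to
  at most \<open>f L\<close> for each \<open>L\<close>.\<close>

lemma card_W0:
  "\<exists>K>0. \<forall>N>0. real (card (W0 N)) \<le> K * real_of_int N powr 0.999"
proof -
  define f :: "nat \<Rightarrow> real" where "f L = 5 * (real L + 1) * 0.97 ^ (L + 1)" for L
  have f: "f L \<ge> 0" for L by (simp add: f_def)
  \<comment> \<open>Enlarging the ratio to 0.98 absorbs the linear factor.\<close>
  have "f \<in> O(\<lambda>L. 0.98 ^ L)" unfolding f_def by real_asymp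
  moreover have "summable (\<lambda>L. norm (0.98 ^ L :: real))" by (simp add: summable_geometric)
  ultimately have sf: "summable f" by (rule summable_comparison_test_bigo[rotated])
  have "real (card (W0 N)) \<le> (suminf f + 1) * real_of_int N powr 0.999" if N: "N > 0" for N
  proof -
    have "\<forall>n\<in>W0 N. \<exists>L. (syracuse ^^ L) n = 1 \<and> real_of_int n powr - 0.999 \<le> f L * path_weight L n"
      unfolding f_def W0_def using W_weight by blast
    then obtain l where l: "\<And>n. n \<in> W0 N \<Longrightarrow> (syracuse ^^ l n) n = 1"
      "\<And>n. n \<in> W0 N \<Longrightarrow> real_of_int n powr - 0.999 \<le> f (l n) * path_weight (l n) n"
      by metis
    have "real (card (W0 N)) * real_of_int N powr - 0.999 = (\<Sum>n\<in>W0 N. real_of_int N powr - 0.999)"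
      by simp
    also have "\<dots> \<le> (\<Sum>n\<in>W0 N. real_of_int n powr - 0.999)"
      by (intro sum_mono powr_mono2') (auto simp: W0_def)
    also have "\<dots> \<le> (\<Sum>n\<in>W0 N. f (l n) * path_weight (l n) n)"
      by (intro sum_mono l)
    also have "\<dots> = (\<Sum>L\<in>l ` W0 N. \<Sum>n\<in>{n \<in> W0 N. l n = L}. f (l n) * path_weight (l n) n)"
      by (rule sum.image_gen[OF finite_W0])
    also have "\<dots> = (\<Sum>L\<in>l ` W0 N. f L * (\<Sum>n\<in>{n \<in> W0 N. l n = L}. path_weight L n))"
      by (simp add: sum_distrib_left)
    also have "\<dots> \<le> (\<Sum>L\<in>l ` W0 N. f L * 1)"
    proof (intro sum_mono mult_left_mono sum_path_weight_le_1 f)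
      show "finite {n \<in> W0 N. l n = L}" for L using finite_W0[of N] by simp
      show "odd n \<and> \<not> 3 dvd n \<and> (syracuse ^^ L) n = 1" if "n \<in> {n \<in> W0 N. l n = L}" for n L
        using that l(1)[of n] by (auto simp: W0_def)
    qed
    also have "\<dots> \<le> suminf f"
      using sum_le_suminf[OF sf, of "l ` W0 N"] finite_W0 f by simp
    finally have "real (card (W0 N)) * real_of_int N powr - 0.999 \<le> suminf f + 1" by simp
    then show ?thesis using N by (simp add: powr_minus divide_simps)
  qed
  moreover have "suminf f \<ge> 0" by (rule suminf_nonneg[OF sf f])
  ultimately show ?thesis by (intro exI[of _ "suminf f + 1"]) auto
qed

section \<open>From odd elements prime to 3 to all of \<open>W\<close>\<close>

text \<open>
  An element of \<open>W\<close> is a power of 2 times an odd number that is prime to 3 or, when \<open>a > 0\<close>, a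
  multiple of 3 whose Syracuse image is \<open>m\<close>.
\<close>

definition decode :: "nat \<times> nat \<times> int \<Rightarrow> int" where
  "decode = (\<lambda>(b, a, m). 2 ^ b * (if a = 0 then m else (2 ^ a * m - 1) div 3))"

lemma pow2_le_imp_le_log:
  assumes "(2::int) ^ a \<le> M"
  shows "a \<le> nat \<lfloor>log 2 (real_of_int M)\<rfloor>"
proof -
  have "(2::real) ^ a \<le> real_of_int M" using assms by (metis of_int_le_iff of_int_numeral of_int_power)
  then have "real a \<le> log 2 (real_of_int M)" by (intro le_log_of_power) auto
  then show ?thesis by (simp add: le_nat_floor)
qed

text \<open>\<open>4 * N\<close> bounds \<open>3 * m + 1\<close> for
  \<open>1 \<le> m \<le> N\<close>, hence both \<open>syracuse m\<close> and
  \<open>2 ^ halvings m\<close>.\<close>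

lemma W_subset_decode:
  fixes N :: int
  defines "M \<equiv> nat \<lfloor>log 2 (real_of_int (4 * N))\<rfloor>"
  shows "W \<inter> {1..N} \<subseteq> decode ` ({..M} \<times> {..M} \<times> W0 (4 * N))"
proof
  fix n assume "n \<in> W \<inter> {1..N}"
  then have n: "n \<in> W" "0 < n" "n \<le> N" by auto
  then have "n \<noteq> 0" by simp
  moreover have "\<not> is_unit (2::int)" by simp
  ultimately obtain m where m: "n = 2 ^ multiplicity 2 n * m" "odd m"
    by (rule multiplicity_decompose')
  define b where "b = multiplicity 2 n"
  have nb: "n = 2 ^ b * m" using m by (simp add: b_def)
  have "m > 0" using nb n by (simp add: zero_less_mult_iff)
  have "1 * m \<le> 2 ^ b * m" using \<open>m > 0\<close> by (intro mult_right_mono) auto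
  then have "m \<le> N" using nb n by simp
  have "2 ^ b * 1 \<le> 2 ^ b * m" using \<open>m > 0\<close> by (intro mult_left_mono) auto
  then have "2 ^ b \<le> 4 * N" using nb n by linarith
  then have b: "b \<le> M" unfolding M_def by (rule pow2_le_imp_le_log)
  have mW: "m \<in> W" using W_core[OF core_pow2[of b m]] n nb by simp
  show "n \<in> decode ` ({..M} \<times> {..M} \<times> W0 (4 * N))"
  proof (cases "3 dvd m")
    case False
    then have "m \<in> W0 (4 * N)" using mW m \<open>m > 0\<close> \<open>m \<le> N\<close> by (simp add: W0_def)
    moreover have "n = decode (b, 0, m)" by (simp add: decode_def nb)
    ultimately show ?thesis using b by (intro image_eqI[of _ _ "(b, 0, m)"]) auto
  next
    case True
    have "syracuse m > 0" using \<open>m > 0\<close> by (rule syracuse_pos)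
    have bound: "2 ^ halvings m * syracuse m \<le> 4 * N"
      using syracuse_eq[of m] \<open>m \<le> N\<close> \<open>m > 0\<close> by simp
    have "1 * syracuse m \<le> 2 ^ halvings m * syracuse m"
      using \<open>syracuse m > 0\<close> by (intro mult_right_mono) auto
    then have "syracuse m \<le> 4 * N" using bound by linarith
    moreover have "syracuse m \<in> W" using W_core[of m "syracuse m"] core_odd[of m] True m mW by simp
    ultimately have "syracuse m \<in> W0 (4 * N)"
      using \<open>syracuse m > 0\<close> by (simp add: W0_def odd_syracuse not_3_dvd_syracuse)
    moreover have "2 ^ halvings m * 1 \<le> 2 ^ halvings m * syracuse m"
      using \<open>syracuse m > 0\<close> by (intro mult_left_mono) auto
    then have "2 ^ halvings m \<le> 4 * N" using bound by linarith
    then have "halvings m \<le> M" unfolding M_def by (rule pow2_le_imp_le_log)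
    \<comment> \<open>\<open>halvings m\<close> is positive for odd \<open>m\<close>, which leaves
      exponent 0 free to mark the other case.\<close>
    moreover have "n = decode (b, halvings m, syracuse m)"
      using halvings_pos[OF m(2)] by (simp add: decode_def nb syracuse_eq)
    ultimately show ?thesis using b by (intro image_eqI[of _ _ "(b, halvings m, syracuse m)"]) auto
  qed
qed

theorem theorem1:
  "\<exists>N0::int. \<forall>N::int. N \<ge> N0 \<longrightarrow>
     real (card (W \<inter> {1..N})) \<le> real_of_int N powr 0.9999"
proof -
  obtain K where K: "K > 0" "\<And>N. N > 0 \<Longrightarrow> real (card (W0 N)) \<le> K * real_of_int N powr 0.999"
    using card_W0 by blast
  \<comment> \<open>The squared logarithm counts the pairs \<open>(b, a)\<close>; the gap between
    0.999 and 0.9999 absorbs it and the constants.\<close>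
  have "eventually (\<lambda>x. (log 2 (4 * x) + 1) ^ 2 * (K * (4 * x) powr 0.999) \<le> x powr 0.9999) at_top"
    using K(1) by real_asymp
  then obtain x0 where x0: "\<And>x. x \<ge> x0 \<Longrightarrow>
      (log 2 (4 * x) + 1) ^ 2 * (K * (4 * x) powr 0.999) \<le> x powr 0.9999"
    by (auto simp: eventually_at_top_linorder)
  have "real (card (W \<inter> {1..N})) \<le> real_of_int N powr 0.9999" if N: "N \<ge> max 1 \<lceil>x0\<rceil>" for N :: int
  proof -
    define M where "M = nat \<lfloor>log 2 (real_of_int (4 * N))\<rfloor>"
    have "log 2 (real_of_int (4 * N)) \<ge> 0" using N by (intro zero_le_log_cancel_iff[THEN iffD2]) auto
    then have M: "real M \<le> log 2 (real_of_int (4 * N))" by (simp add: M_def)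
    have fin: "finite ({..M} \<times> {..M} \<times> W0 (4 * N))" by (simp add: finite_W0)
    have "card (W \<inter> {1..N}) \<le> card ({..M} \<times> {..M} \<times> W0 (4 * N))"
      using W_subset_decode[of N] unfolding M_def[symmetric] by (rule surj_card_le[OF fin])
    also have "\<dots> = (M + 1) ^ 2 * card (W0 (4 * N))"
      by (simp add: card_cartesian_product power2_eq_square algebra_simps)
    finally have "real (card (W \<inter> {1..N})) \<le> real ((M + 1) ^ 2 * card (W0 (4 * N)))"
      by (rule of_nat_mono)
    also have "\<dots> = (real M + 1) ^ 2 * real (card (W0 (4 * N)))" by simp
    also have "\<dots> \<le> (log 2 (4 * real_of_int N) + 1) ^ 2 * (K * (4 * real_of_int N) powr 0.999)"
      using M N K(2)[of "4 * N"] by (intro mult_mono power_mono) auto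
    also have "\<dots> \<le> real_of_int N powr 0.9999"
      using N by (intro x0) linarith
    finally show ?thesis .
  qed
  then show ?thesis by blast
qed

end
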